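(* Let $\delta\in(0,\tfrac12)$ and $p\in(0,\tfrac12)$ be fixed constants (independent of $n$ and $T$). Any (possibly randomized) streaming algorithm for the online learning with experts problem with $n$ experts and $T$ days that, with probability at least $1-p$, achieves regret at most $\delta$ must use $\Omega\!\left(\frac{n}{\delta^2 T}\right)$ bits of memory. This lower bound holds even when the costs are binary (discrete prediction with answers in $\{0,1\}$ and cost $1$ for a wrong answer, $0$ otherwise) and the expert predictions, as well as the correct answer, are i.i.d. across the days (with possibly different distributions across the experts).
   Context: Online learning with experts in the streaming model: there are $n$ experts and $T$ days. On each day $t\in[T]$, the algorithm sees the predictions $x_1^{(t)},\dots,x_n^{(t)}$ of the experts, outputs a prediction, and then receives feedback (in the discrete setting the correct answer $y^{(t)}\in\{0,1\}$, and the costs $c_i^{(t)}\in\{0,1\}$, where $c_i^{(t)}=1$ iff expert $i$'s prediction is wrong, and $c_0^{(t)}$ is the algorithm's cost). The algorithm processes the days in order and cannot revisit past days except through what it stores in memory; its space is the maximum memory it uses. The (average) regret of the algorithm is $\frac{1}{T}\left(\sum_{t=1}^T c_0^{(t)}-\min_{i\in[n]}\sum_{t=1}^T c_i^{(t)}\right)$. *)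

theory Defs
  imports "HOL-Probability.Probability"
begin

text \<open>
  One day of the stream: the list of the predictions of the \<open>n\<close> experts (expert \<open>i < n\<close> predicts
  \<open>xs ! i\<close>), paired with the correct answer, which is revealed only after the algorithm has predicted.
\<close>
type_synonym day = "bool list \<times> bool"

definition days :: "nat \<Rightarrow> day set" where
  "days n = {d. length (fst d) = n}"

definition streams :: "nat \<Rightarrow> nat \<Rightarrow> day list set" where
  "streams n T = {ds. length ds = T \<and> set ds \<subseteq> days n}"

text \<open>
  A deterministic streaming algorithm. The string of bits kept in memory is all that is carried from
  one day to the next. On day \<open>t\<close> the algorithm predicts from \<open>t\<close>, its memory and the experts'
  predictions of that day; after seeing the correct answer it overwrites its memory. Everything else
  is free (the day counter, dependence on \<open>n\<close> and \<open>T\<close>, unbounded computation and work space within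
  one day), so lower bounds for this model apply to more restrictive ones.
\<close>
record stream_alg =
  start :: "bool list"
  predict :: "nat \<Rightarrow> bool list \<Rightarrow> bool list \<Rightarrow> bool"
  update :: "nat \<Rightarrow> bool list \<Rightarrow> bool list \<Rightarrow> bool \<Rightarrow> bool list"

fun memory :: "stream_alg \<Rightarrow> day list \<Rightarrow> nat \<Rightarrow> bool list" where
  "memory A ds 0 = start A"
| "memory A ds (Suc t) = update A t (memory A ds t) (fst (ds ! t)) (snd (ds ! t))"

definition alg_cost :: "stream_alg \<Rightarrow> day list \<Rightarrow> nat \<Rightarrow> real" where
  "alg_cost A ds t = of_bool (predict A t (memory A ds t) (fst (ds ! t)) \<noteq> snd (ds ! t))"

definition expert_cost :: "nat \<Rightarrow> day list \<Rightarrow> nat \<Rightarrow> real" where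
  "expert_cost i ds t = of_bool (fst (ds ! t) ! i \<noteq> snd (ds ! t))"

definition regret :: "nat \<Rightarrow> stream_alg \<Rightarrow> day list \<Rightarrow> real" where
  "regret n A ds =
     ((\<Sum>t<length ds. alg_cost A ds t) - (MIN i\<in>{..<n}. \<Sum>t<length ds. expert_cost i ds t))
     / real (length ds)"

text \<open>
  A randomized streaming algorithm is a distribution over deterministic ones. The random choice may
  thus be consulted on every day without being charged to the memory, which covers both fresh
  private coins on each day and shared randomness; with \<open>n\<close>, \<open>T\<close> and the memory bounded there are
  only finitely many deterministic behaviours, so discrete distributions suffice.
\<close>
type_synonym rand_stream_alg = "stream_alg pmf"

definition uses_memory :: "nat \<Rightarrow> nat \<Rightarrow> nat \<Rightarrow> rand_stream_alg \<Rightarrow> bool" where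
  "uses_memory n T m R \<longleftrightarrow>
     (\<forall>A\<in>set_pmf R. \<forall>ds\<in>streams n T. \<forall>t\<le>T. length (memory A ds t) \<le> m)"

text \<open>
  Input distributions. In \<open>iid_inputs\<close> only the days are independent: within one day the predictions
  and the answer may have any joint distribution.
\<close>
definition all_inputs :: "nat \<Rightarrow> nat \<Rightarrow> day list pmf set" where
  "all_inputs n T = {S. set_pmf S \<subseteq> streams n T}"

definition iid_inputs :: "nat \<Rightarrow> nat \<Rightarrow> day list pmf set" where
  "iid_inputs n T = {replicate_pmf T D | D. set_pmf D \<subseteq> days n}"

text \<open>
  The algorithm is fixed before, and its randomness is independent of, the input. For
  \<open>all_inputs\<close> this is the worst-case guarantee, since point masses on streams are included.
\<close>
definition achieves_regret ::
  "nat \<Rightarrow> day list pmf set \<Rightarrow> real \<Rightarrow> real \<Rightarrow> rand_stream_alg \<Rightarrow> bool" where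
  "achieves_regret n \<S> \<delta> p R \<longleftrightarrow>
     (\<forall>S\<in>\<S>. measure_pmf.prob (pair_pmf R S) {(A, ds). regret n A ds \<le> \<delta>} \<ge> 1 - p)"

definition needs_memory :: "nat \<Rightarrow> nat \<Rightarrow> real \<Rightarrow> real \<Rightarrow> real \<Rightarrow> bool" where
  "needs_memory n T \<delta> p b \<longleftrightarrow>
     (\<forall>\<S>\<in>{all_inputs n T, iid_inputs n T}. \<forall>R m.
        achieves_regret n \<S> \<delta> p R \<and> uses_memory n T m R \<longrightarrow> real m \<ge> b)"

end

theory Submission
  imports Defs
begin

text \<open>
  Let the days be uniform (null model), or let expert \<open>i\<close> alone be right with probability
  \<open>1/2 + \<epsilon>\<close> where \<open>\<delta> < \<epsilon>\<close> (model \<open>i\<close>). Small regret forces fewer mistakes in model \<open>i\<close> than are typical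
  in the null model, so the sequence of messages (memory and mistake of each day) distinguishes the
  two. Let \<open>L\<close> be the likelihood ratio of the messages sent so far. Under the null model the expectation
  of the posterior probability \<open>L / (1 + L)\<close> falls each day by at most the chi-squared divergence of
  the day's message, which is \<open>4 \<epsilon>\<^sup>2 \<bbbE>[\<bbbE>[s\<^sub>i | message]\<^sup>2]\<close>, where \<open>s\<^sub>i = 1\<close> if expert \<open>i\<close> is right and
  \<open>s\<^sub>i = -1\<close> otherwise. Summed over the experts, these conditional means are controlled by the
  level-1 inequality: a message carrying \<open>m + 1\<close> bits contributes \<open>O(\<epsilon>\<^sup>2 m)\<close>. Distinguishing all \<open>n\<close>
  models therefore takes \<open>T \<epsilon>\<^sup>2 m = \<Omega>(n)\<close>. For large \<open>T\<close> one takes \<open>\<epsilon>\<close> of order \<open>\<delta>\<close>; for \<open>\<epsilon> = 1/2\<close> the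
  argument works for all \<open>T\<close>, because fewer than \<open>T/2\<close> mistakes have null probability at most \<open>1/2\<close>.
\<close>

section \<open>Likelihood ratios of transcripts\<close>

text \<open>The expectation over \<open>k\<close> independent draws when \<open>w\<close> sums to 1.
  Peeling off the first draw matches the recursion of \<open>transcript\<close>.\<close>

primrec seq_sum :: "'a set \<Rightarrow> ('a \<Rightarrow> real) \<Rightarrow> nat \<Rightarrow> ('a list \<Rightarrow> real) \<Rightarrow> real" where
  "seq_sum X w 0 h = h []"
| "seq_sum X w (Suc k) h = (\<Sum>d\<in>X. w d * seq_sum X w k (\<lambda>ds. h (d # ds)))"

lemma seq_sum_add:
  "seq_sum X w k (\<lambda>ds. g ds + h ds) = seq_sum X w k g + seq_sum X w k h"
  by (induction k arbitrary: g h) (simp_all add: sum.distrib algebra_simps)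

lemma seq_sum_cmult: "seq_sum X w k (\<lambda>ds. c * h ds) = c * seq_sum X w k h"
  by (induction k arbitrary: h) (simp_all add: sum_distrib_left algebra_simps)

lemma seq_sum_const: "sum w X = 1 \<Longrightarrow> seq_sum X w k (\<lambda>_. c) = c"
  by (induction k) (simp_all flip: sum_distrib_right)

lemma seq_sum_mono:
  assumes "\<And>d. d \<in> X \<Longrightarrow> 0 \<le> w d"
    and "\<And>ds. length ds = k \<Longrightarrow> set ds \<subseteq> X \<Longrightarrow> g ds \<le> h ds"
  shows "seq_sum X w k g \<le> seq_sum X w k h"
  using assms(2)
proof (induction k arbitrary: g h)
  case (Suc k)
  show ?case
    using assms(1) Suc.prems by (auto intro!: sum_mono mult_left_mono Suc.IH)
qed simp

lemma expectation_replicate_pmf: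
  assumes "finite X" "set_pmf D \<subseteq> X"
  shows "measure_pmf.expectation (replicate_pmf k D) h = seq_sum X (pmf D) k h"
proof (induction k arbitrary: h)
  case (Suc k)
  have fin: "finite (set_pmf (replicate_pmf k D))"
    unfolding set_replicate_pmf
    by (rule finite_subset[OF _ finite_lists_length_eq[of X k]])
       (use assms in \<open>auto simp: lists_eq_set\<close>)
  have "measure_pmf.expectation (replicate_pmf (Suc k) D) h
      = measure_pmf.expectation (D \<bind> (\<lambda>x. map_pmf ((#) x) (replicate_pmf k D))) h"
    by (simp add: map_pmf_def)
  also have "\<dots> = (\<Sum>d\<in>X. pmf D d *\<^sub>R
      measure_pmf.expectation (map_pmf ((#) d) (replicate_pmf k D)) h)"
    by (rule pmf_expectation_bind) (use assms fin in auto)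
  finally show ?case by (simp add: Suc.IH)
qed simp

text \<open>Conditional mean of \<open>s\<close> given \<open>f = z\<close> under the uniform law on
  \<open>X\<close>; on an empty fiber the division by zero makes it 0.\<close>

definition fiber_mean :: "'a set \<Rightarrow> ('a \<Rightarrow> 'z) \<Rightarrow> ('a \<Rightarrow> real) \<Rightarrow> 'z \<Rightarrow> real" where
  "fiber_mean X f s z = (\<Sum>d\<in>{d \<in> X. f d = z}. s d) / real (card {d \<in> X. f d = z})"

lemma fiber_mean_cmult: "fiber_mean X f (\<lambda>d. c * s d) z = c * fiber_mean X f s z"
  by (simp add: fiber_mean_def sum_distrib_left)

lemma abs_fiber_mean_le:
  assumes "\<And>d. d \<in> X \<Longrightarrow> \<bar>s d\<bar> \<le> 1"
  shows "\<bar>fiber_mean X f s z\<bar> \<le> 1"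
proof (cases "card {d \<in> X. f d = z} = 0")
  case False
  have "\<bar>\<Sum>d\<in>{d \<in> X. f d = z}. s d\<bar> \<le> real (card {d \<in> X. f d = z}) * 1"
    by (rule order.trans[OF sum_abs sum_bounded_above]) (use assms in auto)
  with False show ?thesis by (simp add: fiber_mean_def field_simps)
qed (simp add: fiber_mean_def)

text \<open>Tower property: \<open>H (f d)\<close> is constant on each fiber, so \<open>s\<close>
  may be replaced there by its conditional mean.\<close>

lemma sum_fiber_mean:
  assumes "finite X"
  shows "(\<Sum>d\<in>X. fiber_mean X f s (f d) * H (f d)) = (\<Sum>d\<in>X. s d * H (f d))"
proof -
  have "(\<Sum>d\<in>{d \<in> X. f d = z}. fiber_mean X f s (f d) * H (f d))
      = (\<Sum>d\<in>{d \<in> X. f d = z}. s d * H (f d))" if "z \<in> f ` X" for z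
  proof -
    have "card {d \<in> X. f d = z} \<noteq> 0"
      using that assms by (auto simp: card_eq_0_iff)
    then show ?thesis
      by (simp add: fiber_mean_def flip: sum_distrib_right)
  qed
  then show ?thesis
    by (subst (1 2) sum.image_gen[OF assms, of _ f]) simp
qed

text \<open>Each message is also the state from which the next day starts, so the past acts only
  through the last message and likelihood ratios factor over the days.\<close>

primrec transcript :: "(nat \<Rightarrow> 'z \<Rightarrow> 'a \<Rightarrow> 'z) \<Rightarrow> nat \<Rightarrow> 'z \<Rightarrow> 'a list \<Rightarrow> 'z list" where
  "transcript F t z [] = []"
| "transcript F t z (d # ds) = F t z d # transcript F (Suc t) (F t z d) ds"

text \<open>Density of the transcript under \<open>tilted_weight X s\<close> relative to the uniform
  law: tilting multiplies the probability of passing from \<open>z\<close> to \<open>z'\<close> by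
  \<open>1 + fiber_mean X (F t z) s z'\<close>.\<close>

primrec lratio ::
  "'a set \<Rightarrow> (nat \<Rightarrow> 'z \<Rightarrow> 'a \<Rightarrow> 'z) \<Rightarrow> ('a \<Rightarrow> real) \<Rightarrow> nat \<Rightarrow> 'z \<Rightarrow> 'z list \<Rightarrow> real" where
  "lratio X F s t z [] = 1"
| "lratio X F s t z (z' # zs) = (1 + fiber_mean X (F t z) s z') * lratio X F s (Suc t) z' zs"

text \<open>The chi-squared divergence of one message is the mean square of its density minus 1,
  that is, of \<open>fiber_mean\<close>. The divergences of \<open>k\<close> days are added in
  expectation under the uniform law.\<close>

primrec leakage ::
  "'a set \<Rightarrow> (nat \<Rightarrow> 'z \<Rightarrow> 'a \<Rightarrow> 'z) \<Rightarrow> ('a \<Rightarrow> real) \<Rightarrow> nat \<Rightarrow> nat \<Rightarrow> 'z \<Rightarrow> real" where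
  "leakage X F s 0 t z = 0"
| "leakage X F s (Suc k) t z =
     (\<Sum>d\<in>X. (fiber_mean X (F t z) s (F t z d))\<^sup>2 + leakage X F s k (Suc t) (F t z d)) / card X"

abbreviation "uniform_weight X \<equiv> (\<lambda>_. 1 / real (card X))"
abbreviation "tilted_weight X s \<equiv> (\<lambda>d. (1 + s d) / real (card X))"

text \<open>The tower property day by day, with \<open>H\<close> collecting all that follows the
  first message.\<close>

lemma change_of_measure:
  assumes "finite X"
  shows "seq_sum X (tilted_weight X s) k (\<lambda>ds. h (transcript F t z ds)) =
         seq_sum X (uniform_weight X) k
           (\<lambda>ds. h (transcript F t z ds) * lratio X F s t z (transcript F t z ds))"
proof (induction k arbitrary: h t z)
  case (Suc k)
  define H where "H z' = seq_sum X (uniform_weight X) k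
     (\<lambda>ds. h (z' # transcript F (Suc t) z' ds) * lratio X F s (Suc t) z' (transcript F (Suc t) z' ds))"
    for z'
  have IH: "seq_sum X (tilted_weight X s) k (\<lambda>ds. h (z' # transcript F (Suc t) z' ds)) = H z'" for z'
    unfolding H_def by (rule Suc.IH[of "\<lambda>zs. h (z' # zs)"])
  have "(\<Sum>d\<in>X. (1 + s d) * H (F t z d))
      = (\<Sum>d\<in>X. H (F t z d)) + (\<Sum>d\<in>X. fiber_mean X (F t z) s (F t z d) * H (F t z d))"
    by (simp add: sum_fiber_mean[OF assms, where H = H] sum.distrib ring_distribs)
  also have "\<dots> = (\<Sum>d\<in>X. (1 + fiber_mean X (F t z) s (F t z d)) * H (F t z d))"
    by (simp add: sum.distrib ring_distribs)
  finally have eq: "(\<Sum>d\<in>X. (1 + s d) * H (F t z d))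
      = (\<Sum>d\<in>X. (1 + fiber_mean X (F t z) s (F t z d)) * H (F t z d))" .
  have "seq_sum X (uniform_weight X) k (\<lambda>ds. h (F t z d # transcript F (Suc t) (F t z d) ds) *
      ((1 + fiber_mean X (F t z) s (F t z d)) *
        lratio X F s (Suc t) (F t z d) (transcript F (Suc t) (F t z d) ds)))
      = (1 + fiber_mean X (F t z) s (F t z d)) * H (F t z d)" for d
    unfolding H_def by (subst seq_sum_cmult[symmetric]) (simp add: mult_ac)
  then show ?case
    using eq by (simp add: IH flip: sum_divide_distrib)
qed simp

lemma lratio_nonneg:
  assumes "\<And>d. d \<in> X \<Longrightarrow> \<bar>s d\<bar> \<le> 1"
  shows "0 \<le> lratio X F s t z zs"
proof (induction zs arbitrary: t z)
  case (Cons z' zs)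
  have "0 \<le> 1 + fiber_mean X (F t z) s z'"
    using abs_fiber_mean_le[of X s "F t z" z'] assms by (simp add: abs_le_iff)
  with Cons show ?case by simp
qed simp

section \<open>Posterior probabilities and tests between two models\<close>

lemma posterior_step:
  fixes c u :: real
  assumes "0 \<le> c" "-1 \<le> u"
  shows "c / (1 + c) + c / (1 + c)\<^sup>2 * u - u\<^sup>2 \<le> (c * (1 + u)) / (1 + c * (1 + u))"
proof -
  define D where "D = 1 + c * (1 + u)"
  have D: "D \<ge> 1" and C: "1 + c \<ge> 1" using assms by (auto simp: D_def)
  \<comment> \<open>A message turns the odds \<open>c\<close> into \<open>c * (1 + u)\<close>. This
    is the exact remainder of the posterior against its tangent at \<open>u = 0\<close>; the linear
    term will average out in the null model.\<close>
  have *: "c * (1 + u) / D - c / (1 + c) - c / (1 + c)\<^sup>2 * u = - ((c / (1 + c))\<^sup>2 * u\<^sup>2 / D)"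
  proof -
    have "c * (1 + u) / D - c / (1 + c) = c * u / (D * (1 + c))"
      using D C by (simp add: field_simps) (simp add: D_def algebra_simps)
    also have "\<dots> - c / (1 + c)\<^sup>2 * u = c * u * ((1 + c) - D) / (D * (1 + c)\<^sup>2)"
      using D C by (simp add: divide_simps power2_eq_square) (simp add: algebra_simps)
    also have "(1 + c) - D = - (c * u)" by (simp add: D_def algebra_simps)
    finally show ?thesis by (simp add: power_divide power_mult_distrib power2_eq_square mult_ac)
  qed
  have "(c / (1 + c))\<^sup>2 \<le> 1"
    using assms by (simp add: power_le_one_iff)
  then have "(c / (1 + c))\<^sup>2 * u\<^sup>2 \<le> u\<^sup>2"
    by (simp add: mult_left_le_one_le)
  also have "\<dots> \<le> u\<^sup>2 * D" using D by (simp add: mult_le_cancel_left1)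
  finally have "(c / (1 + c))\<^sup>2 * u\<^sup>2 / D \<le> u\<^sup>2"
    using D by (subst pos_divide_le_eq) auto
  with * show ?thesis unfolding D_def by linarith
qed

text \<open>The two sides differ by \<open>((1 - L) - \<kappa> * \<sigma> * (1 + L))\<^sup>2 / (4 *
  (1 + L))\<close>, where \<open>\<sigma> = 1 - 2 * h\<close>. The right side is linear in
  \<open>L\<close>, \<open>h\<close> and \<open>h * L\<close>, whose null expectations are 1 and the
  probabilities of the test under the null and the tilted law.\<close>

lemma posterior_tangent:
  fixes L \<kappa> h :: real
  assumes "0 \<le> L" "h = 0 \<or> h = 1"
  shows "L / (1 + L) \<le> (1/4 - \<kappa>/2 + \<kappa>\<^sup>2/4) + (1/4 + \<kappa>/2 + \<kappa>\<^sup>2/4) * L + \<kappa> * h - \<kappa> * (h * L)"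
proof -
  define \<sigma> where "\<sigma> = 1 - 2 * h"
  have s2: "\<sigma>\<^sup>2 = 1" using assms(2) by (auto simp: \<sigma>_def)
  have "((1 - L) - \<kappa> * \<sigma> * (1 + L))\<^sup>2 / (4 * (1 + L)) \<ge> 0" using assms(1) by simp
  also have "((1 - L) - \<kappa> * \<sigma> * (1 + L))\<^sup>2 =
      (1 - L)\<^sup>2 - 2 * \<kappa> * \<sigma> * (1 - L) * (1 + L) + \<kappa>\<^sup>2 * \<sigma>\<^sup>2 * (1 + L)\<^sup>2"
    by (simp add: power2_eq_square algebra_simps)
  also have "\<dots> / (4 * (1 + L)) =
      (1/4 - \<kappa>/2 + \<kappa>\<^sup>2/4) + (1/4 + \<kappa>/2 + \<kappa>\<^sup>2/4) * L + \<kappa> * h - \<kappa> * (h * L) - L / (1 + L)"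
    unfolding s2 using assms(1) by (simp add: divide_simps \<sigma>_def) (simp add: power2_eq_square algebra_simps)
  finally show ?thesis by simp
qed

text \<open>The odds \<open>c\<close> are arbitrary because the first message changes them for the
  remaining days. The linear terms of \<open>posterior_step\<close> cancel since \<open>s\<close>
  has mean 0, and the squares add up to the leakage.\<close>

lemma posterior_lower_bound:
  assumes "finite X" "X \<noteq> {}" "\<And>d. d \<in> X \<Longrightarrow> \<bar>s d\<bar> \<le> 1" "sum s X = 0" "0 \<le> c"
  shows "c / (1 + c) - leakage X F s k t z \<le>
    seq_sum X (uniform_weight X) k (\<lambda>ds. (c * lratio X F s t z (transcript F t z ds)) /
                            (1 + c * lratio X F s t z (transcript F t z ds)))"
  using assms(5)
proof (induction k arbitrary: t z c)
  case (Suc k)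
  have N: "real (card X) > 0" using assms(1,2) by (simp add: card_gt_0_iff)
  define g where "g d = fiber_mean X (F t z) s (F t z d)" for d
  have g: "-1 \<le> g d" for d
    using abs_fiber_mean_le[of X s "F t z" "F t z d"] assms(3) by (simp add: g_def abs_le_iff)
  have sum_g: "sum g X = 0"
    using sum_fiber_mean[OF assms(1), of "F t z" s "\<lambda>_. 1"] assms(4) by (simp add: g_def)
  define W where "W d = seq_sum X (uniform_weight X) k (\<lambda>ds.
      (c * (1 + g d) * lratio X F s (Suc t) (F t z d) (transcript F (Suc t) (F t z d) ds)) /
      (1 + c * (1 + g d) * lratio X F s (Suc t) (F t z d) (transcript F (Suc t) (F t z d) ds)))" for d
  have W: "c / (1 + c) + c / (1 + c)\<^sup>2 * g d - ((g d)\<^sup>2 + leakage X F s k (Suc t) (F t z d)) \<le> W d" for d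
    using Suc.IH[of "c * (1 + g d)" "Suc t" "F t z d"] posterior_step[OF Suc.prems g[of d]]
      g[of d] Suc.prems unfolding W_def by fastforce
  have "c / (1 + c) - leakage X F s (Suc k) t z
    = (\<Sum>d\<in>X. c / (1 + c) + c / (1 + c)\<^sup>2 * g d - ((g d)\<^sup>2 + leakage X F s k (Suc t) (F t z d))) / card X"
    using N sum_g
    by (simp add: sum.distrib sum_subtractf g_def[symmetric] diff_divide_distrib add_divide_distrib
        del: times_divide_eq_left flip: sum_distrib_left)
  also have "\<dots> \<le> (\<Sum>d\<in>X. W d) / card X"
    by (intro divide_right_mono sum_mono W) simp
  also have "\<dots> = seq_sum X (uniform_weight X) (Suc k) (\<lambda>ds. (c * lratio X F s t z (transcript F t z ds)) /
                            (1 + c * lratio X F s t z (transcript F t z ds)))"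
    unfolding W_def g_def by (simp add: sum_divide_distrib mult.assoc)
  finally show ?case .
qed simp

text \<open>
  The best \<open>\<kappa>\<close> is the advantage itself. With a fixed \<open>\<kappa>\<close> the bound stays linear in the two
  probabilities and can be averaged over the randomness of the algorithm and over the experts.
\<close>
lemma distinguishing_advantage_le_leakage:
  assumes X: "finite X" "X \<noteq> {}" and s: "\<And>d. d \<in> X \<Longrightarrow> \<bar>s d\<bar> \<le> 1" "sum s X = 0"
  shows "\<kappa> * (seq_sum X (tilted_weight X s) k (\<lambda>ds. of_bool (P (transcript F t z ds)))
            - seq_sum X (uniform_weight X) k (\<lambda>ds. of_bool (P (transcript F t z ds)))) - \<kappa>\<^sup>2 / 2
         \<le> leakage X F s k t z"
proof -
  let ?S = "seq_sum X (uniform_weight X) k"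
  define L where "L ds = lratio X F s t z (transcript F t z ds)" for ds
  define h :: "'a list \<Rightarrow> real" where "h ds = of_bool (P (transcript F t z ds))" for ds
  have w: "sum (uniform_weight X) X = 1" using X by simp
  have EL: "?S L = 1"
  proof -
    have "?S L = seq_sum X (tilted_weight X s) k (\<lambda>_. 1)"
      using change_of_measure[OF X(1), of s k "\<lambda>_. 1" F t z] by (simp add: L_def[abs_def])
    moreover have "sum (tilted_weight X s) X = 1"
      using X s(2) by (simp add: sum.distrib flip: sum_divide_distrib)
    ultimately show ?thesis by (simp add: seq_sum_const)
  qed
  have EhL: "?S (\<lambda>ds. h ds * L ds) = seq_sum X (tilted_weight X s) k h"
    using change_of_measure[OF X(1), of s k "\<lambda>zs. of_bool (P zs)" F t z]
    by (simp add: L_def[abs_def] h_def[abs_def])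
  \<comment> \<open>Even odds start the posterior at 1/2, which cancels against the constant of the
    tangent bound.\<close>
  have "1/2 - leakage X F s k t z \<le> ?S (\<lambda>ds. L ds / (1 + L ds))"
    using posterior_lower_bound[OF X s, of 1 F k t z] by (simp add: L_def)
  also have "\<dots> \<le> ?S (\<lambda>ds. (1/4 - \<kappa>/2 + \<kappa>\<^sup>2/4) + ((1/4 + \<kappa>/2 + \<kappa>\<^sup>2/4) * L ds
      + (\<kappa> * h ds + (- \<kappa>) * (h ds * L ds))))"
  proof (rule seq_sum_mono)
    fix ds
    have "0 \<le> L ds" "h ds = 0 \<or> h ds = 1"
      by (auto simp: L_def h_def intro: lratio_nonneg s(1))
    from posterior_tangent[OF this, of \<kappa>]
    show "L ds / (1 + L ds) \<le> (1/4 - \<kappa>/2 + \<kappa>\<^sup>2/4) + ((1/4 + \<kappa>/2 + \<kappa>\<^sup>2/4) * L ds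
      + (\<kappa> * h ds + (- \<kappa>) * (h ds * L ds)))" by linarith
  qed simp
  also have "\<dots> = 1/2 + \<kappa>\<^sup>2/2 - \<kappa> * (seq_sum X (tilted_weight X s) k h - ?S h)"
    unfolding seq_sum_add seq_sum_cmult EhL EL seq_sum_const[OF w] by (simp add: algebra_simps)
  finally show ?thesis by (simp add: h_def[abs_def])
qed

section \<open>The level-1 inequality and moments\<close>

lemma two_power_fact_le: "2 ^ k * fact k \<le> (fact (2 * k) :: real)"
proof (induction k)
  case (Suc k)
  have "2 ^ Suc k * fact (Suc k) = real (2 * Suc k) * (2 ^ k * fact k)"
    by (simp add: algebra_simps)
  also have "\<dots> \<le> real (2 * Suc k) * fact (2 * k)"
    using Suc by (intro mult_left_mono) simp_all
  also have "\<dots> \<le> real (2 * Suc k) * (real (2 * k + 1) * fact (2 * k))"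
    by (intro mult_left_mono) (simp_all add: mult_le_cancel_right1)
  also have "\<dots> = fact (2 * Suc k)"
    by (simp add: algebra_simps)
  finally show ?case .
qed simp

text \<open>Termwise comparison of the power series, the one of the exponential being interleaved
  with zeros at the odd powers.\<close>

lemma cosh_le_exp_half_square: "cosh x \<le> exp (x\<^sup>2 / 2)" for x :: real
proof -
  have "(\<lambda>k. (x\<^sup>2 / 2) ^ k /\<^sub>R fact k) sums exp (x\<^sup>2 / 2)"
    by (rule exp_converges)
  from sums_if[OF sums_zero this]
  have *: "(\<lambda>n. if even n then (x\<^sup>2 / 2) ^ (n div 2) /\<^sub>R fact (n div 2) else 0) sums exp (x\<^sup>2 / 2)"
    by simp
  show ?thesis
  proof (rule sums_le[OF _ cosh_converges *])
    fix n
    show "(if even n then x ^ n /\<^sub>R fact n else 0)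
        \<le> (if even n then (x\<^sup>2 / 2) ^ (n div 2) /\<^sub>R fact (n div 2) else 0)"
    proof (cases "even n")
      case True
      then obtain k where n: "n = 2 * k" by blast
      have "(x\<^sup>2) ^ k / fact (2 * k) \<le> (x\<^sup>2) ^ k / (2 ^ k * fact k)"
        by (intro divide_left_mono two_power_fact_le) simp_all
      moreover have "(x\<^sup>2 / 2) ^ k /\<^sub>R fact k = (x\<^sup>2) ^ k / (2 ^ k * fact k)"
        by (simp add: power_divide field_simps)
      moreover have "x ^ n /\<^sub>R fact n = (x\<^sup>2) ^ k / fact (2 * k)"
        unfolding n power_mult by (simp add: divide_inverse_commute)
      ultimately show ?thesis
        by (simp add: n)
    qed simp
  qed
qed

text \<open>Level-1 inequality: test the generating function at the vector \<open>a\<close> of fiber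
  means itself. By Jensen its mean over the fiber is at least \<open>exp Q\<close>, while its sum
  over all of \<open>X\<close> is at most \<open>card X * exp (Q / 2)\<close>.\<close>

lemma sum_squares_fiber_mean_le:
  assumes X: "finite X"
    and subgaussian: "\<And>a. (\<Sum>d\<in>X. exp (\<Sum>i<n. a i * s i d)) \<le> card X * exp ((\<Sum>i<n. (a i)\<^sup>2) / 2)"
    and z: "z \<in> f ` X"
  shows "(\<Sum>i<n. (fiber_mean X f (s i) z)\<^sup>2) \<le> 2 * ln (card X / card {d \<in> X. f d = z})"
proof -
  define B where "B = {d \<in> X. f d = z}"
  define a where "a i = fiber_mean X f (s i) z" for i
  define Q where "Q = (\<Sum>i<n. (a i)\<^sup>2)"
  have B: "finite B" "B \<subseteq> X" "card B > 0" "card X > 0"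
    using X z by (auto simp: B_def card_gt_0_iff)
  have a: "(\<Sum>d\<in>B. s i d) = card B * a i" for i
    using B(3) by (simp add: a_def fiber_mean_def flip: B_def)
  have "(\<Sum>d\<in>B. \<Sum>i<n. a i * s i d) = (\<Sum>i<n. a i * (\<Sum>d\<in>B. s i d))"
    by (subst sum.swap) (simp add: sum_distrib_left)
  also have "\<dots> = card B * Q"
    by (simp add: a Q_def sum_distrib_left power2_eq_square mult_ac)
  finally have mean: "(\<Sum>d\<in>B. \<Sum>i<n. a i * s i d) = card B * Q" .
  \<comment> \<open>Jensen on the fiber, by way of the tangent of \<open>exp\<close> at the mean
    \<open>Q\<close>.\<close>
  have "card B * exp Q = (\<Sum>d\<in>B. exp Q * (1 + ((\<Sum>i<n. a i * s i d) - Q)))"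
    by (simp add: sum.distrib sum_subtractf mean flip: sum_distrib_left)
  also have "\<dots> \<le> (\<Sum>d\<in>B. exp Q * exp ((\<Sum>i<n. a i * s i d) - Q))"
    by (intro sum_mono mult_left_mono exp_ge_add_one_self) simp
  also have "\<dots> = (\<Sum>d\<in>B. exp (\<Sum>i<n. a i * s i d))"
    by (simp flip: exp_add)
  also have "\<dots> \<le> (\<Sum>d\<in>X. exp (\<Sum>i<n. a i * s i d))"
    using B X by (intro sum_mono2) auto
  also have "\<dots> \<le> card X * exp (Q / 2)"
    using subgaussian[of a] by (simp add: Q_def)
  finally have "exp (Q / 2) * exp (Q / 2) * card B \<le> card X * exp (Q / 2)"
    by (simp add: mult_ac flip: exp_add)
  then have "exp (Q / 2) * card B \<le> card X"
    by (simp add: mult_ac)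
  then have "exp (Q / 2) \<le> card X / card B"
    using B by (simp add: field_simps)
  then have "Q / 2 \<le> ln (card X / card B)"
    using B by (subst ln_ge_iff) auto
  then show ?thesis by (simp add: Q_def a_def B_def)
qed

text \<open>The mean of the logarithms in the level-1 inequality is the entropy of the message, at
  most the logarithm of the number of messages.\<close>

lemma mean_sum_squares_fiber_mean_le:
  fixes K :: real
  assumes X: "finite X" "X \<noteq> {}"
    and subgaussian: "\<And>a. (\<Sum>d\<in>X. exp (\<Sum>i<n. a i * s i d)) \<le> card X * exp ((\<Sum>i<n. (a i)\<^sup>2) / 2)"
    and K: "real (card (f ` X)) \<le> K"
  shows "(\<Sum>d\<in>X. \<Sum>i<n. (fiber_mean X f (s i) (f d))\<^sup>2) / card X \<le> 2 * ln K"
proof -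
  define N where "N = real (card X)"
  define b where "b z = real (card {d \<in> X. f d = z})" for z
  have N: "N > 0" using X by (simp add: N_def card_gt_0_iff)
  have b: "b (f d) > 0" if "d \<in> X" for d
    using X that by (auto simp: b_def card_gt_0_iff)
  have "card (f ` X) > 0" using X by (simp add: card_gt_0_iff)
  then have Kpos: "K > 0" using K by linarith
  have "(\<Sum>d\<in>X. 1 / b (f d)) = (\<Sum>z\<in>f ` X. \<Sum>d\<in>{d \<in> X. f d = z}. 1 / b (f d))"
    by (rule sum.image_gen[OF X(1)])
  also have "\<dots> = (\<Sum>z\<in>f ` X. b z * (1 / b z))"
    by (intro sum.cong) (simp_all add: b_def)
  also have "\<dots> = card (f ` X)"
    by (subst sum.cong[OF refl, of _ _ "\<lambda>_. 1"]) (use b in force)+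
  finally have fibers: "(\<Sum>d\<in>X. 1 / b (f d)) \<le> K" using K by simp
  have "(\<Sum>d\<in>X. \<Sum>i<n. (fiber_mean X f (s i) (f d))\<^sup>2)
      \<le> (\<Sum>d\<in>X. 2 * (ln K + N / K * (1 / b (f d)) - 1))"
  proof (rule sum_mono)
    fix d assume d: "d \<in> X"
    have "ln (N / b (f d)) = ln K + ln (N / b (f d) / K)"
      using N Kpos b[OF d] by (simp add: ln_div ln_mult)
    \<comment> \<open>Tangent of the logarithm; its mean over \<open>X\<close> is controlled because
      the reciprocal fiber sizes sum to the number of fibers.\<close>
    also have "ln (N / b (f d) / K) \<le> N / b (f d) / K - 1"
      using N Kpos b[OF d] by (intro ln_le_minus_one) simp
    finally have "ln (N / b (f d)) \<le> ln K + N / K * (1 / b (f d)) - 1"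
      by (simp add: mult_ac)
    then show "(\<Sum>i<n. (fiber_mean X f (s i) (f d))\<^sup>2) \<le> 2 * (ln K + N / K * (1 / b (f d)) - 1)"
      using sum_squares_fiber_mean_le[OF X(1) subgaussian, of "f d" f] d
      unfolding N_def[symmetric] b_def[symmetric] by simp
  qed
  also have "\<dots> = 2 * (N * ln K + N / K * (\<Sum>d\<in>X. 1 / b (f d)) - N)"
    by (simp add: sum.distrib sum_subtractf N_def sum_distrib_left algebra_simps)
  also have "\<dots> \<le> 2 * (N * ln K + N / K * K - N)"
    using N Kpos fibers by (intro mult_left_mono diff_right_mono add_left_mono) auto
  also have "\<dots> = N * (2 * ln K)" using Kpos by simp
  finally show ?thesis using N by (simp add: N_def field_simps)
qed

text \<open>The level-1 bound holds from every state, so it passes through the recursion whatever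
  state is reached.\<close>

lemma sum_leakage_le:
  fixes K :: real
  assumes X: "finite X" "X \<noteq> {}"
    and subgaussian: "\<And>a. (\<Sum>d\<in>X. exp (\<Sum>i<n. a i * s i d)) \<le> card X * exp ((\<Sum>i<n. (a i)\<^sup>2) / 2)"
    and K: "\<And>t z. real (card (F t z ` X)) \<le> K"
  shows "(\<Sum>i<n. leakage X F (\<lambda>d. c * s i d) k t z) \<le> real k * (2 * c\<^sup>2 * ln K)"
proof (induction k arbitrary: t z)
  case (Suc k)
  have "(\<Sum>i<n. leakage X F (\<lambda>d. c * s i d) (Suc k) t z)
    = c\<^sup>2 * ((\<Sum>d\<in>X. \<Sum>i<n. (fiber_mean X (F t z) (s i) (F t z d))\<^sup>2) / card X)
      + (\<Sum>d\<in>X. \<Sum>i<n. leakage X F (\<lambda>d. c * s i d) k (Suc t) (F t z d)) / card X"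
    by (subst (1 2) sum.swap)
      (simp add: fiber_mean_cmult power_mult_distrib sum.distrib add_divide_distrib
        sum_distrib_left sum_divide_distrib)
  also have "\<dots> \<le> c\<^sup>2 * (2 * ln K) + (\<Sum>d\<in>X. real k * (2 * c\<^sup>2 * ln K)) / card X"
    by (intro add_mono mult_left_mono mean_sum_squares_fiber_mean_le X subgaussian K
        divide_right_mono sum_mono Suc.IH) simp_all
  also have "\<dots> = real (Suc k) * (2 * c\<^sup>2 * ln K)"
    using X by (simp add: algebra_simps)
  finally show ?case .
qed simp

section \<open>Second moments of sums of independent draws\<close>

lemma seq_sum_square_sum_list:
  assumes "sum w X = 1" "(\<Sum>d\<in>X. w d * v d) = 0" "(\<Sum>d\<in>X. w d * (v d)\<^sup>2) = q"
  shows "seq_sum X w k (\<lambda>ds. (a + sum_list (map v ds))\<^sup>2) = a\<^sup>2 + real k * q"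
\<comment> \<open>The offset \<open>a\<close> absorbs the draws already made.\<close>
proof (induction k arbitrary: a)
  case (Suc k)
  have "seq_sum X w (Suc k) (\<lambda>ds. (a + sum_list (map v ds))\<^sup>2)
    = (\<Sum>d\<in>X. w d * seq_sum X w k (\<lambda>ds. ((a + v d) + sum_list (map v ds))\<^sup>2))"
    by (simp add: add_ac)
  also have "\<dots> = (\<Sum>d\<in>X. (a\<^sup>2 + real k * q) * w d + 2 * a * (w d * v d) + w d * (v d)\<^sup>2)"
    unfolding Suc.IH by (simp add: power2_eq_square algebra_simps)
  also have "\<dots> = a\<^sup>2 + real (Suc k) * q"
proof -
    have "(\<Sum>d\<in>X. 2 * a * (w d * v d)) = 2 * a * (\<Sum>d\<in>X. w d * v d)"
      "(\<Sum>d\<in>X. (a\<^sup>2 + real k * q) * w d) = (a\<^sup>2 + real k * q) * sum w X"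
      by (simp_all only: sum_distrib_left)
    then show ?thesis unfolding sum.distrib assms by (simp add: algebra_simps)
  qed
  finally show ?case .
qed simp

lemma seq_sum_Markov_square:
  assumes "\<And>d. d \<in> X \<Longrightarrow> 0 \<le> w d" "0 < b"
    and "\<And>ds. length ds = k \<Longrightarrow> set ds \<subseteq> X \<Longrightarrow> P ds \<Longrightarrow> b\<^sup>2 \<le> (Y ds)\<^sup>2"
    and "seq_sum X w k (\<lambda>ds. (Y ds)\<^sup>2) \<le> q"
  shows "seq_sum X w k (\<lambda>ds. of_bool (P ds)) \<le> q / b\<^sup>2"
proof -
  have "seq_sum X w k (\<lambda>ds. of_bool (P ds)) \<le> seq_sum X w k (\<lambda>ds. 1 / b\<^sup>2 * (Y ds)\<^sup>2)"
    using assms(2,3) by (intro seq_sum_mono assms(1)) (auto simp: field_simps)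
  also have "\<dots> \<le> 1 / b\<^sup>2 * q"
    unfolding seq_sum_cmult by (intro mult_left_mono assms(4)) simp
  finally show ?thesis by simp
qed

section \<open>Days, experts and algorithms\<close>

lemma days_eq_Times: "days n = {xs. length xs = n} \<times> UNIV"
  by (auto simp: days_def)

lemma finite_lists_bool_length: "finite {xs :: bool list. length xs = n}"
  using finite_lists_length_eq[of "UNIV :: bool set" n] by simp

lemma card_lists_bool_length: "card {xs :: bool list. length xs = n} = 2 ^ n"
  using card_lists_length_eq[of "UNIV :: bool set" n] by simp

lemma finite_days: "finite (days n)"
  by (simp add: days_eq_Times finite_lists_bool_length)

lemma card_days: "card (days n) = 2 ^ Suc n"
  by (simp add: days_eq_Times card_cartesian_product card_lists_bool_length)

lemma days_nonempty: "days n \<noteq> {}"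
  using card_days[of n] by auto

lemma sum_days: "sum f (days n) = (\<Sum>xs | length xs = n. f (xs, True) + f (xs, False))"
  by (simp add: days_eq_Times UNIV_bool sum.cartesian_product' add.commute)

definition agree :: "nat \<Rightarrow> day \<Rightarrow> real" where
  "agree i d = (if fst d ! i = snd d then 1 else -1)"

lemma abs_agree [simp]: "\<bar>agree i d\<bar> = 1" and agree_square [simp]: "(agree i d)\<^sup>2 = 1"
  by (simp_all add: agree_def)

lemma sum_agree: "sum (agree i) (days n) = 0"
  by (auto simp: sum_days agree_def intro!: sum.neutral)

lemma sum_prod_lists_bool:
  fixes f :: "nat \<Rightarrow> bool \<Rightarrow> real"
  shows "(\<Sum>xs | length xs = n. \<Prod>i<n. f i (xs ! i)) = (\<Prod>i<n. f i True + f i False)"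
proof (induction n arbitrary: f)
  case (Suc n)
  have eq: "{xs :: bool list. length xs = Suc n} = (\<lambda>(b, xs). b # xs) ` (UNIV \<times> {xs. length xs = n})"
    by (auto simp: length_Suc_conv)
  have "(\<Sum>xs | length xs = Suc n. \<Prod>i<Suc n. f i (xs ! i))
      = (\<Sum>(b, xs)\<in>UNIV \<times> {xs. length xs = n}. f 0 b * (\<Prod>i<n. f (Suc i) (xs ! i)))"
    unfolding eq 
    by (subst sum.reindex)
      (auto simp: inj_on_def prod.lessThan_Suc_shift simp del: prod.lessThan_Suc intro!: sum.cong)
  also have "\<dots> = (\<Sum>b\<in>UNIV. f 0 b * (\<Prod>i<n. f (Suc i) True + f (Suc i) False))"
    by (subst sum.cartesian_product[symmetric]) (simp add: Suc.IH[of "\<lambda>i. f (Suc i)"] flip: sum_distrib_left)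
  also have "\<dots> = (\<Prod>i<Suc n. f i True + f i False)"
    by (simp add: prod.lessThan_Suc_shift UNIV_bool algebra_simps del: prod.lessThan_Suc)
  finally show ?case .
qed simp

text \<open>Once the answer \<open>y\<close> is fixed, the agreements are independent fair signs, so
  the generating function is a product of \<open>cosh\<close>.\<close>

lemma agree_subgaussian:
  "(\<Sum>d\<in>days n. exp (\<Sum>i<n. a i * agree i d)) \<le> card (days n) * exp ((\<Sum>i<n. (a i)\<^sup>2) / 2)"
proof -
  have *: "(\<Sum>xs | length xs = n. exp (\<Sum>i<n. a i * agree i (xs, y))) = (\<Prod>i<n. 2 * cosh (a i))" for y
  proof -
    have "(\<Sum>xs | length xs = n. exp (\<Sum>i<n. a i * agree i (xs, y)))
        = (\<Sum>xs | length xs = n. \<Prod>i<n. exp (a i * (if xs ! i = y then 1 else -1)))"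
      by (simp add: exp_sum agree_def)
    also have "\<dots> = (\<Prod>i<n. 2 * cosh (a i))"
      by (subst sum_prod_lists_bool) (auto simp: cosh_def intro!: prod.cong)
    finally show ?thesis .
  qed
  have "(\<Sum>d\<in>days n. exp (\<Sum>i<n. a i * agree i d)) = 2 * (\<Prod>i<n. 2 * cosh (a i))"
    by (simp add: sum_days sum.distrib *)
  also have "\<dots> \<le> 2 * (\<Prod>i<n. 2 * exp ((a i)\<^sup>2 / 2))"
    by (intro mult_left_mono prod_mono) (auto intro: cosh_le_exp_half_square)
  also have "\<dots> = card (days n) * exp ((\<Sum>i<n. (a i)\<^sup>2) / 2)"
    by (simp add: prod.distrib exp_sum sum_divide_distrib card_days)
  finally show ?thesis .
qed

section \<open>Payoffs in the null model and in the biased models\<close>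

definition payoff :: "'z \<times> bool \<Rightarrow> real" where
  "payoff z = (if snd z then -1 else 1)"

text \<open>The prediction is made before a fair answer is revealed, so exactly one of the two
  answers is a mistake: for any algorithm the null payoffs are independent fair signs.\<close>

lemma seq_sum_signs:
  assumes F: "\<And>t z d. snd (F t z d) \<longleftrightarrow> (q t z (fst d) \<noteq> snd d)"
  shows "seq_sum (days n) (uniform_weight (days n)) k (\<lambda>ds. h (map payoff (transcript F t z ds)))
       = seq_sum {-1, 1} (\<lambda>_. 1 / 2) k h"
proof (induction k arbitrary: h t z)
  case (Suc k)
  define H where "H x = seq_sum {-1, 1} (\<lambda>_. 1 / 2) k (\<lambda>xs. h (x # xs))" for x
  have IH: "seq_sum (days n) (uniform_weight (days n)) k
      (\<lambda>ds. h (payoff (F t z d) # map payoff (transcript F (Suc t) (F t z d) ds))) = H (payoff (F t z d))" for d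
    unfolding H_def by (rule Suc.IH)
  have "(\<Sum>d\<in>days n. H (payoff (F t z d))) = (\<Sum>xs :: bool list | length xs = n. H 1 + H (-1))"
  proof -
    have "H (payoff (F t z (xs, True))) + H (payoff (F t z (xs, False))) = H 1 + H (-1)" for xs
      by (cases "q t z xs") (simp_all add: payoff_def F)
    then show ?thesis by (simp add: sum_days)
  qed
  also have "\<dots> = 2 ^ n * (H 1 + H (-1))"
    by (simp add: card_lists_bool_length)
  finally have "(\<Sum>d\<in>days n. H (payoff (F t z d))) / card (days n) = H 1 / 2 + H (-1) / 2"
    by (simp add: card_days field_simps)
  then show ?case
    by (simp add: IH flip: sum_divide_distrib) (simp add: H_def)
qed simp

lemma seq_sum_signs_uminus:
  "seq_sum {-1, 1} (\<lambda>_. 1 / 2) k (\<lambda>xs. h (map uminus xs)) = seq_sum {-1, 1 :: real} (\<lambda>_. 1 / 2) k h"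
proof (induction k arbitrary: h)
  case (Suc k)
  from Suc[of "\<lambda>xs. h (1 # xs)"] Suc[of "\<lambda>xs. h (-1 # xs)"] show ?case by simp
qed simp

text \<open>The event and its mirror image are disjoint and equally likely. Unlike a variance bound,
  this is useful for every \<open>k\<close>.\<close>

lemma seq_sum_signs_pos_le:
  assumes "0 < \<theta>"
  shows "seq_sum {-1, 1 :: real} (\<lambda>_. 1 / 2) k (\<lambda>xs. of_bool (\<theta> \<le> sum_list xs)) \<le> 1 / 2"
proof -
  let ?S = "seq_sum {-1, 1 :: real} (\<lambda>_. 1 / 2) k"
  have neg: "sum_list (map uminus xs) = - sum_list xs" for xs :: "real list"
    by (induction xs) simp_all
  have "?S (\<lambda>xs. of_bool (\<theta> \<le> sum_list xs)) + ?S (\<lambda>xs. of_bool (\<theta> \<le> sum_list (map uminus xs)))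
      \<le> ?S (\<lambda>_. 1)"
    unfolding seq_sum_add[symmetric]
    using assms by (intro seq_sum_mono) (auto simp: neg)
  also have "\<dots> = 1" by (simp add: seq_sum_const)
  finally show ?thesis
    by (simp add: seq_sum_signs_uminus[of k "\<lambda>xs. of_bool (\<theta> \<le> sum_list xs)"])
qed

lemma seq_sum_signs_ge_le:
  assumes "0 < b"
  shows "seq_sum {-1, 1 :: real} (\<lambda>_. 1 / 2) k (\<lambda>xs. of_bool (b \<le> sum_list xs)) \<le> real k / b\<^sup>2"
proof (rule seq_sum_Markov_square[where Y = sum_list])
  show "seq_sum {-1, 1 :: real} (\<lambda>_. 1 / 2) k (\<lambda>ds. (sum_list ds)\<^sup>2) \<le> real k"
    using seq_sum_square_sum_list[of "\<lambda>_. 1/2" "{-1, 1 :: real}" "\<lambda>x. x" 1 k 0] by simp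
qed (use assms in \<open>auto intro: power_mono\<close>)

text \<open>The law of a day on which expert \<open>i\<close> is right with probability \<open>1/2 + \<epsilon>\<close>.\<close>
abbreviation biased_weight :: "nat \<Rightarrow> real \<Rightarrow> nat \<Rightarrow> day \<Rightarrow> real" where
  "biased_weight n \<epsilon> i \<equiv> tilted_weight (days n) (\<lambda>d. 2 * \<epsilon> * agree i d)"

text \<open>Total mass, mean \<open>2 * \<epsilon>\<close> and variance of \<open>agree i\<close>.
  The variance vanishes at \<open>\<epsilon> = 1/2\<close>, where the expert is never wrong.\<close>

lemma sum_biased_weight:
  "(\<Sum>d\<in>days n. biased_weight n \<epsilon> i d) = 1"
  "(\<Sum>d\<in>days n. biased_weight n \<epsilon> i d * (agree i d - 2 * \<epsilon>)) = 0"
  "(\<Sum>d\<in>days n. biased_weight n \<epsilon> i d * (agree i d - 2 * \<epsilon>)\<^sup>2) = 1 - 4 * \<epsilon>\<^sup>2"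
proof -
  have N: "real (card (days n)) \<noteq> 0" by (simp add: card_days)
  have w: "(1 + 2 * \<epsilon> * agree i d) * (agree i d - 2 * \<epsilon>) = (1 - 4 * \<epsilon>\<^sup>2) * agree i d"
    "(1 + 2 * \<epsilon> * agree i d) * (agree i d - 2 * \<epsilon>)\<^sup>2 = (1 - 4 * \<epsilon>\<^sup>2) - 2 * \<epsilon> * (1 - 4 * \<epsilon>\<^sup>2) * agree i d"
    for d
    by (simp_all add: agree_def power2_eq_square algebra_simps)
  show "(\<Sum>d\<in>days n. biased_weight n \<epsilon> i d) = 1"
    using N by (simp add: sum.distrib sum_agree flip: sum_divide_distrib sum_distrib_left)
  show "(\<Sum>d\<in>days n. biased_weight n \<epsilon> i d * (agree i d - 2 * \<epsilon>)) = 0"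
    by (simp add: w sum_agree flip: sum_divide_distrib sum_distrib_left)
  show "(\<Sum>d\<in>days n. biased_weight n \<epsilon> i d * (agree i d - 2 * \<epsilon>)\<^sup>2) = 1 - 4 * \<epsilon>\<^sup>2"
    using N by (simp add: w sum_agree sum_subtractf flip: sum_divide_distrib sum_distrib_left)
qed

lemma biased_weight_nonneg:
  assumes "0 \<le> \<epsilon>" "\<epsilon> \<le> 1/2"
  shows "0 \<le> biased_weight n \<epsilon> i d"
  using assms by (simp add: agree_def)

lemma seq_sum_biased_low_le:
  assumes "0 \<le> \<epsilon>" "\<epsilon> \<le> 1/2" "0 < b"
  shows "seq_sum (days n) (biased_weight n \<epsilon> i) k
           (\<lambda>ds. of_bool (sum_list (map (agree i) ds) \<le> 2 * \<epsilon> * real k - b)) \<le>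
         real k * (1 - 4 * \<epsilon>\<^sup>2) / b\<^sup>2"
proof (rule seq_sum_Markov_square[where Y = "\<lambda>ds. sum_list (map (\<lambda>d. agree i d - 2 * \<epsilon>) ds)"])
  show "seq_sum (days n) (biased_weight n \<epsilon> i) k
      (\<lambda>ds. (sum_list (map (\<lambda>d. agree i d - 2 * \<epsilon>) ds))\<^sup>2) \<le> real k * (1 - 4 * \<epsilon>\<^sup>2)"
    using seq_sum_square_sum_list[OF sum_biased_weight, of n \<epsilon> i k 0] by simp
  fix ds :: "day list"
  assume "length ds = k" "sum_list (map (agree i) ds) \<le> 2 * \<epsilon> * real k - b"
  then have "b \<le> - sum_list (map (\<lambda>d. agree i d - 2 * \<epsilon>) ds)"
    by (simp add: sum_list_subtractf sum_list_triv mult_ac)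
  then show "b\<^sup>2 \<le> (sum_list (map (\<lambda>d. agree i d - 2 * \<epsilon>) ds))\<^sup>2"
    using \<open>0 < b\<close> power_mono[of b _ 2] by fastforce
qed (use assms biased_weight_nonneg in auto)

section \<open>From weighted sums to probability mass functions\<close>

lemma ex_pmf_with_weights:
  assumes "finite X" "\<And>d. d \<in> X \<Longrightarrow> 0 \<le> w d" "sum w X = 1"
  obtains D where "set_pmf D \<subseteq> X" "\<And>d. d \<in> X \<Longrightarrow> pmf D d = w d"
proof -
  define f where "f d = (if d \<in> X then w d else 0)" for d
  have nonneg: "0 \<le> f d" for d using assms by (simp add: f_def)
  have "(\<integral>\<^sup>+ d. ennreal (f d) \<partial>count_space UNIV) = (\<Sum>d\<in>X. ennreal (f d))"
    using assms(1) by (rule nn_integral_count_space') (simp_all add: f_def)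
  also have "\<dots> = 1"
    using assms nonneg by simp (simp add: f_def)
  finally have pmf: "pmf (embed_pmf f) d = f d" for d
    using nonneg by (intro pmf_embed_pmf) auto
  show ?thesis
  proof
    show "set_pmf (embed_pmf f) \<subseteq> X"
      using pmf by (auto simp: set_pmf_eq f_def split: if_splits)
    show "pmf (embed_pmf f) d = w d" if "d \<in> X" for d
      using that by (simp add: pmf f_def)
  qed
qed

lemma seq_sum_cong_weight:
  assumes "\<And>d. d \<in> X \<Longrightarrow> w d = w' d"
  shows "seq_sum X w k h = seq_sum X w' k h"
  by (induction k arbitrary: h) (simp_all add: assms)

lemma prob_replicate_pmf:
  assumes "finite X" "set_pmf D \<subseteq> X" "\<And>d. d \<in> X \<Longrightarrow> pmf D d = w d"
  shows "measure_pmf.prob (replicate_pmf k D) {ds. P ds} = seq_sum X w k (\<lambda>ds. of_bool (P ds))"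
proof -
  have "measure_pmf.prob (replicate_pmf k D) {ds. P ds}
      = measure_pmf.expectation (replicate_pmf k D) (\<lambda>ds. of_bool (P ds))"
    by (subst Bochner_Integration.integral_cong[OF refl, of _ _ "indicator {ds. P ds}"])
      (auto simp: indicator_def)
  also have "\<dots> = seq_sum X w k (\<lambda>ds. of_bool (P ds))"
    unfolding expectation_replicate_pmf[OF assms(1,2)] by (rule seq_sum_cong_weight[OF assms(3)])
  finally show ?thesis .
qed

lemma prob_pair_pmf:
  "measure_pmf.prob (pair_pmf A B) {(x, y). P x y}
    = measure_pmf.expectation A (\<lambda>x. measure_pmf.prob B {y. P x y})"
proof -
  have "ennreal (measure_pmf.prob (pair_pmf A B) {(x, y). P x y})
      = (\<integral>\<^sup>+ x. \<integral>\<^sup>+ y. indicator {(x, y). P x y} (x, y) \<partial>B \<partial>A)"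
    by (simp add: nn_integral_pair_pmf' flip: measure_pmf.emeasure_eq_measure nn_integral_indicator)
  also have "\<dots> = (\<integral>\<^sup>+ x. \<integral>\<^sup>+ y. indicator {y. P x y} y \<partial>B \<partial>A)"
    by (simp add: indicator_def)
  also have "\<dots> = (\<integral>\<^sup>+ x. ennreal (measure_pmf.prob B {y. P x y}) \<partial>A)"
    by (simp add: measure_pmf.emeasure_eq_measure)
  also have "\<dots> = ennreal (measure_pmf.expectation A (\<lambda>x. measure_pmf.prob B {y. P x y}))"
    by (intro nn_integral_eq_integral measure_pmf.integrable_const_bound[where B = 1]) auto
  finally show ?thesis by (simp add: integral_nonneg)
qed

text \<open>Averaging as in Yao's principle. The bound concerns the sum over \<open>i\<close>, since
  a deterministic algorithm may do well against some of the inputs.\<close>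

lemma sum_prob_pair_pmf_le:
  fixes c :: real
  assumes "\<And>x. x \<in> set_pmf A \<Longrightarrow> (\<Sum>i\<in>I. measure_pmf.prob (B i) {y. P x y}) \<le> c"
  shows "(\<Sum>i\<in>I. measure_pmf.prob (pair_pmf A (B i)) {(x, y). P x y}) \<le> c"
proof -
  have int: "integrable (measure_pmf A) (\<lambda>x. measure_pmf.prob (B i) {y. P x y})" for i
    by (intro measure_pmf.integrable_const_bound[where B = 1]) auto
  have "(\<Sum>i\<in>I. measure_pmf.prob (pair_pmf A (B i)) {(x, y). P x y})
      = measure_pmf.expectation A (\<lambda>x. \<Sum>i\<in>I. measure_pmf.prob (B i) {y. P x y})"
    using int by (simp add: prob_pair_pmf)
  also have "\<dots> \<le> c"
    using int assms by (intro measure_pmf.integral_le_const) (auto simp: AE_measure_pmf_iff)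
  finally show ?thesis .
qed

section \<open>Messages of an algorithm, payoff and regret\<close>

lemma transcript_nth:
  assumes "j < length ds"
  shows "(z # transcript F t z ds) ! Suc j = F (t + j) ((z # transcript F t z ds) ! j) (ds ! j)"
  using assms
proof (induction ds arbitrary: t z j)
  case (Cons d ds)
  show ?case
  proof (cases j)
    case (Suc i)
    then show ?thesis using Cons.IH[of i "F t z d" "Suc t"] Cons.prems by simp
  qed simp
qed simp

lemma length_transcript [simp]: "length (transcript F t z ds) = length ds"
  by (induction ds arbitrary: t z) simp_all

text \<open>
  The message of a day is the new memory together with the mistake made on that day. The mistakes
  cost one bit per day, whereas keeping their number in the memory would cost \<open>log T\<close> bits.
  Cutting the memory off at \<open>m\<close> bits bounds the number of messages also at unreachable states.
\<close>
definition day_step :: "stream_alg \<Rightarrow> nat \<Rightarrow> nat \<Rightarrow> bool list \<times> bool \<Rightarrow> day \<Rightarrow> bool list \<times> bool" where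
  "day_step A m t z d =
     (take m (update A t (fst z) (fst d) (snd d)), predict A t (fst z) (fst d) \<noteq> snd d)"

lemma fst_day_step: "fst (day_step A m t z d) = take m (update A t (fst z) (fst d) (snd d))"
  and snd_day_step: "snd (day_step A m t z d) \<longleftrightarrow> predict A t (fst z) (fst d) \<noteq> snd d"
  by (simp_all add: day_step_def)

abbreviation messages :: "stream_alg \<Rightarrow> nat \<Rightarrow> day list \<Rightarrow> (bool list \<times> bool) list" where
  "messages A m ds \<equiv> transcript (day_step A m) 0 (start A, False) ds"

lemma card_day_step_le: "real (card (day_step A m t z ` X)) \<le> 2 ^ (m + 2)"
proof -
  have fin: "finite {xs :: bool list. length xs \<le> m}"
    using finite_lists_length_le[of "UNIV :: bool set" m] by simp
  have "card {xs :: bool list. length xs \<le> m} = (\<Sum>i\<le>m. 2 ^ i)"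
    using card_lists_length_le[of "UNIV :: bool set" m] by simp
  also have "\<dots> \<le> 2 ^ (m + 1)"
    using sum_power2[of "Suc m"] by (simp add: lessThan_Suc_atMost atLeast0LessThan)
  finally have card: "card {xs :: bool list. length xs \<le> m} \<le> 2 ^ (m + 1)" .
  have "card (day_step A m t z ` X) \<le> card ({xs :: bool list. length xs \<le> m} \<times> (UNIV :: bool set))"
    using fin by (intro card_mono) (auto simp: day_step_def)
  also have "\<dots> \<le> 2 ^ (m + 2)"
    using card by (simp add: card_cartesian_product)
  finally show ?thesis
    by (metis of_nat_le_iff of_nat_numeral of_nat_power)
qed

text \<open>Prepending the initial state makes index \<open>j\<close> the state before day
  \<open>j\<close>. Under the memory bound the cut-off \<open>take m\<close> changes nothing on the
  given stream.\<close>

lemma fst_messages_nth: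
  assumes "\<And>t. t \<le> length ds \<Longrightarrow> length (memory A ds t) \<le> m" "j \<le> length ds"
  shows "fst (((start A, False) # messages A m ds) ! j) = memory A ds j"
  using assms(2)
proof (induction j)
  case (Suc j)
  then have "((start A, False) # messages A m ds) ! Suc j
      = day_step A m j (((start A, False) # messages A m ds) ! j) (ds ! j)"
    by (subst transcript_nth) auto
  then show ?case
    using Suc assms(1)[of "Suc j"] by (simp add: fst_day_step del: nth_Cons_Suc)
qed simp

lemma sum_list_payoff_messages:
  assumes "\<And>t. t \<le> length ds \<Longrightarrow> length (memory A ds t) \<le> m"
  shows "sum_list (map payoff (messages A m ds)) = length ds - 2 * (\<Sum>t<length ds. alg_cost A ds t)"
proof -
  have "payoff (messages A m ds ! j) = 1 - 2 * alg_cost A ds j" if "j < length ds" for j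
  proof -
    have "messages A m ds ! j = day_step A m j (((start A, False) # messages A m ds) ! j) (ds ! j)"
      using transcript_nth[OF that, of "(start A, False)" "day_step A m" 0] by simp
    then show ?thesis
      using fst_messages_nth[OF assms, where j = j] that
      by (simp add: payoff_def day_step_def alg_cost_def)
  qed
  then show ?thesis
    by (simp add: sum_list_sum_nth atLeast0LessThan sum_subtractf sum_distrib_left)
qed

lemma sum_list_agree:
  "sum_list (map (agree i) ds) = length ds - 2 * (\<Sum>t<length ds. expert_cost i ds t)"
proof -
  have "agree i (ds ! t) = 1 - 2 * expert_cost i ds t" for t
    by (simp add: agree_def expert_cost_def)
  then show ?thesis
    by (simp add: sum_list_sum_nth atLeast0LessThan sum_subtractf sum_distrib_left)
qed

lemma regret_ge_expert:
  assumes "i < n"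
  shows "((\<Sum>t<length ds. alg_cost A ds t) - (\<Sum>t<length ds. expert_cost i ds t)) / length ds \<le> regret n A ds"
  unfolding regret_def using assms by (intro divide_right_mono diff_left_mono Min_le) auto

lemma payoff_ge_of_regret_le:
  assumes "regret n A ds \<le> \<delta>" "i < n" "0 < length ds"
    and "\<And>t. t \<le> length ds \<Longrightarrow> length (memory A ds t) \<le> m"
  shows "sum_list (map (agree i) ds) - 2 * \<delta> * length ds \<le> sum_list (map payoff (messages A m ds))"
proof -
  have "((\<Sum>t<length ds. alg_cost A ds t) - (\<Sum>t<length ds. expert_cost i ds t)) / length ds \<le> \<delta>"
    using regret_ge_expert[OF assms(2)] assms(1) by (rule order.trans)
  then have "(\<Sum>t<length ds. alg_cost A ds t) - (\<Sum>t<length ds. expert_cost i ds t) \<le> \<delta> * length ds"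
    using assms(3) by (simp add: pos_divide_le_eq)
  then show ?thesis
    using assms(4) by (simp add: sum_list_payoff_messages sum_list_agree)
qed

section \<open>Lower bounds\<close>

text \<open>Here \<alpha> bounds the null probability of a high payoff, \<beta> the probability that
  the good expert falls far below its mean, and \<kappa> is a distinguishing advantage that
  remains.\<close>

lemma expert_memory_bound:
  fixes \<delta> \<epsilon> \<alpha> \<beta> \<kappa> p :: real
  assumes R: "achieves_regret n (iid_inputs n T) \<delta> p R" "uses_memory n T m R"
    and \<epsilon>: "0 < \<epsilon>" "\<delta> < \<epsilon>" "\<epsilon> \<le> 1/2" and T: "0 < T"
    and \<alpha>: "seq_sum {-1, 1} (\<lambda>_. 1 / 2) T (\<lambda>xs. of_bool ((\<epsilon> - \<delta>) * T \<le> sum_list xs)) \<le> \<alpha>"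
    and \<beta>: "real T * (1 - 4 * \<epsilon>\<^sup>2) / ((\<epsilon> - \<delta>) * T)\<^sup>2 \<le> \<beta>"
    and \<kappa>: "0 < \<kappa>" "\<kappa> \<le> 1 - p - \<alpha> - \<beta>"
  shows "real n * \<kappa>\<^sup>2 \<le> 16 * \<epsilon>\<^sup>2 * real T * (real m + 2)"
proof -
  \<comment> \<open>Half of \<open>2 * (\<epsilon> - \<delta>) * T\<close>, the mean payoff of the
    good expert less the allowed regret: one half covers the expert's deviation, the other separates
    from the null mean 0.\<close>
  define b where "b = (\<epsilon> - \<delta>) * T"
  have b: "0 < b" using \<epsilon> T by (simp add: b_def)
  let ?s = "\<lambda>i d. 2 * \<epsilon> * agree i d"
  have s: "\<bar>?s i d\<bar> \<le> 1" "sum (?s i) (days n) = 0" for i d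
    using \<epsilon> by (simp_all add: abs_mult sum_agree flip: sum_distrib_left)
  have "\<exists>D. set_pmf D \<subseteq> days n \<and> (\<forall>d\<in>days n. pmf D d = biased_weight n \<epsilon> i d)" for i
    using ex_pmf_with_weights[OF finite_days biased_weight_nonneg sum_biased_weight(1), of n \<epsilon> i] \<epsilon>
    by (metis less_imp_le)
  then obtain D where D: "\<And>i. set_pmf (D i) \<subseteq> days n"
      "\<And>i d. d \<in> days n \<Longrightarrow> pmf (D i) d = biased_weight n \<epsilon> i d"
    by metis
  define E where "E = 8 * \<epsilon>\<^sup>2 * real T * (real m + 2)"
  \<comment> \<open>\<open>E\<close> bounds the total leakage; \<open>C\<close> is the resulting
    bound on the sum of the success probabilities of a deterministic algorithm over the
    \<open>n\<close> models.\<close>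
  define C where "C = real n * (\<alpha> + \<beta> + \<kappa> / 2) + E / \<kappa>"
  have ln_le: "ln (2 ^ (m + 2)) \<le> real m + 2"
  proof -
    have "ln (2 ^ (m + 2)) = (real m + 2) * ln 2"
      by (subst ln_realpow) simp_all
    also have "\<dots> \<le> (real m + 2) * 1"
      by (intro mult_left_mono) (use ln_le_minus_one[of 2] in auto)
    finally show ?thesis by simp
  qed
  have "(\<Sum>i<n. measure_pmf.prob (replicate_pmf T (D i)) {ds. regret n A ds \<le> \<delta>}) \<le> C"
    if A: "A \<in> set_pmf R" for A
  proof -
    let ?P = "\<lambda>zs. b \<le> sum_list (map payoff zs)"
    let ?tr = "\<lambda>ds. ?P (messages A m ds)"
    let ?leak = "\<lambda>i. leakage (days n) (day_step A m) (?s i) T 0 (start A, False)"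
    have null: "seq_sum (days n) (uniform_weight (days n)) T (\<lambda>ds. of_bool (?tr ds)) \<le> \<alpha>"
      using seq_sum_signs[of "day_step A m" "\<lambda>t z. predict A t (fst z)" n T
          "\<lambda>xs. of_bool (b \<le> sum_list xs)" 0 "(start A, False)"] \<alpha>
      by (simp add: snd_day_step b_def)
    have prob: "measure_pmf.prob (replicate_pmf T (D i)) {ds. regret n A ds \<le> \<delta>} \<le>
        seq_sum (days n) (biased_weight n \<epsilon> i) T (\<lambda>ds. of_bool (?tr ds)) + \<beta>" if i: "i < n" for i
    proof -
      let ?low = "\<lambda>ds. sum_list (map (agree i) ds) \<le> 2 * \<epsilon> * real T - b"
      have "?tr ds \<or> ?low ds" if "length ds = T" "set ds \<subseteq> days n" "regret n A ds \<le> \<delta>" for ds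
      proof -
        have "length (memory A ds t) \<le> m" if "t \<le> T" for t
          using R(2) A \<open>length ds = T\<close> \<open>set ds \<subseteq> days n\<close> that
          by (auto simp: uses_memory_def streams_def)
        then show ?thesis
          using payoff_ge_of_regret_le[of n A ds \<delta> i m] that i T by (auto simp: b_def algebra_simps)
      qed
      then have "seq_sum (days n) (biased_weight n \<epsilon> i) T (\<lambda>ds. of_bool (regret n A ds \<le> \<delta>)) \<le>
          seq_sum (days n) (biased_weight n \<epsilon> i) T (\<lambda>ds. of_bool (?tr ds) + of_bool (?low ds))"
        using \<epsilon> by (intro seq_sum_mono biased_weight_nonneg) fastforce+
      also have "\<dots> \<le> seq_sum (days n) (biased_weight n \<epsilon> i) T (\<lambda>ds. of_bool (?tr ds)) + \<beta>"
        unfolding seq_sum_add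
        using seq_sum_biased_low_le[of \<epsilon> b n i T] \<epsilon> b \<beta> by (simp add: b_def)
      finally show ?thesis
        by (subst prob_replicate_pmf[OF finite_days D(1) D(2)])
    qed
    have "\<kappa> * (measure_pmf.prob (replicate_pmf T (D i)) {ds. regret n A ds \<le> \<delta>} - \<alpha> - \<beta>) - \<kappa>\<^sup>2 / 2
        \<le> ?leak i" if "i < n" for i
    proof -
      have "\<kappa> * (measure_pmf.prob (replicate_pmf T (D i)) {ds. regret n A ds \<le> \<delta>} - \<alpha> - \<beta>)
        \<le> \<kappa> * (seq_sum (days n) (biased_weight n \<epsilon> i) T (\<lambda>ds. of_bool (?tr ds))
              - seq_sum (days n) (uniform_weight (days n)) T (\<lambda>ds. of_bool (?tr ds)))"
        using prob[OF that] null \<kappa> by (intro mult_left_mono) auto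
      with distinguishing_advantage_le_leakage[OF finite_days days_nonempty, of n "?s i" \<kappa> T ?P
          "day_step A m" 0 "(start A, False)"] s
      show ?thesis by simp
    qed
    then have "(\<Sum>i<n. \<kappa> * (measure_pmf.prob (replicate_pmf T (D i)) {ds. regret n A ds \<le> \<delta>} - \<alpha> - \<beta>)
        - \<kappa>\<^sup>2 / 2) \<le> (\<Sum>i<n. ?leak i)"
      by (intro sum_mono) simp
    also have "\<dots> \<le> real T * (2 * (2 * \<epsilon>)\<^sup>2 * ln (2 ^ (m + 2)))"
      by (rule sum_leakage_le[OF finite_days days_nonempty agree_subgaussian card_day_step_le])
    also have "\<dots> \<le> real T * (2 * (2 * \<epsilon>)\<^sup>2 * (real m + 2))"
      by (intro mult_left_mono ln_le) simp_all
    finally have "\<kappa> * (\<Sum>i<n. measure_pmf.prob (replicate_pmf T (D i)) {ds. regret n A ds \<le> \<delta>})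
        \<le> real n * (\<kappa> * (\<alpha> + \<beta>) + \<kappa>\<^sup>2 / 2) + E"
      by (simp add: E_def sum_subtractf power_mult_distrib algebra_simps flip: sum_distrib_left)
    also have "\<dots> = \<kappa> * C"
      using \<kappa> by (simp add: C_def power2_eq_square field_simps)
    finally show ?thesis using \<kappa> by simp
  qed
  then have "(\<Sum>i<n. measure_pmf.prob (pair_pmf R (replicate_pmf T (D i))) {(A, ds). regret n A ds \<le> \<delta>}) \<le> C"
    by (rule sum_prob_pair_pmf_le)
  moreover have "1 - p \<le> measure_pmf.prob (pair_pmf R (replicate_pmf T (D i))) {(A, ds). regret n A ds \<le> \<delta>}"
    for i
    using R(1) D(1)[of i] by (auto simp: achieves_regret_def iid_inputs_def)
  then have "(\<Sum>i<n. 1 - p) \<le>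
      (\<Sum>i<n. measure_pmf.prob (pair_pmf R (replicate_pmf T (D i))) {(A, ds). regret n A ds \<le> \<delta>})"
    by (intro sum_mono)
  ultimately have "real n * (1 - p) \<le> C" by simp
  moreover have "real n * (\<alpha> + \<beta> + \<kappa>) \<le> real n * (1 - p)"
    using \<kappa> by (intro mult_left_mono) auto
  \<comment> \<open>Half of the advantage is lost to the term \<open>\<kappa>\<^sup>2 / 2\<close> of
    the tangent bound.\<close>
  ultimately have "real n * (\<kappa> / 2) \<le> E / \<kappa>"
    unfolding C_def distrib_left by linarith
  then show ?thesis
    using \<kappa> by (simp add: E_def pos_le_divide_eq power2_eq_square)
qed

lemma replicate_pmf_return_pmf: "replicate_pmf k (return_pmf x) = return_pmf (replicate k x)"
  by (induction k) (simp_all add: bind_return_pmf)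

text \<open>
  Without memory the algorithm predicts alike on the two constant streams that differ only in the
  answers, so its two numbers of mistakes add up to \<open>T\<close>, while each stream has a perfect expert.
\<close>
lemma memory_positive:
  assumes R: "achieves_regret n (iid_inputs n T) \<delta> p R" "uses_memory n T m R"
    and n: "2 \<le> n" and T: "0 < T" and \<delta>: "\<delta> < 1/2" and p: "p < 1/2"
  shows "m \<noteq> 0"
proof
  assume m: "m = 0"
  define xs where "xs = True # replicate (n - 1) False"
  have xs: "length xs = n" "xs ! 0" "\<not> xs ! 1"
    using n by (auto simp: xs_def nth_Cons split: nat.split)
  define ds :: "bool \<Rightarrow> day list" where "ds y = replicate T (xs, y)" for y
  have "(\<Sum>y\<in>UNIV. measure_pmf.prob (return_pmf (ds y)) {d. regret n A d \<le> \<delta>}) \<le> 1"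
    if A: "A \<in> set_pmf R" for A
  proof -
    have mem: "memory A (ds y) t = []" if "t < T" for t y
      using R(2) A that m xs(1) by (force simp: uses_memory_def streams_def days_def ds_def)
    have "(\<Sum>t<T. alg_cost A (ds True) t) + (\<Sum>t<T. alg_cost A (ds False) t) = (\<Sum>t<T. 1)"
      unfolding sum.distrib[symmetric]
      by (intro sum.cong) (auto simp: alg_cost_def mem, simp_all add: ds_def)
    then have "(\<Sum>t<T. alg_cost A (ds True) t) / T + (\<Sum>t<T. alg_cost A (ds False) t) / T = 1"
      using T by (simp flip: add_divide_distrib)
    moreover have "(\<Sum>t<T. alg_cost A (ds y) t) / T \<le> regret n A (ds y)" for y
    proof -
      have "(\<Sum>t<T. expert_cost (if y then 0 else 1) (ds y) t) = 0"
        using xs by (intro sum.neutral) (auto simp: expert_cost_def ds_def)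
      then show ?thesis
        using regret_ge_expert[of "if y then 0 else 1" n A "ds y"] n by (simp add: ds_def)
    qed
    ultimately have "1 \<le> regret n A (ds True) + regret n A (ds False)"
      by (metis add_mono)
    then have "\<not> regret n A (ds True) \<le> \<delta> \<or> \<not> regret n A (ds False) \<le> \<delta>"
      using \<delta> by linarith
    then obtain y\<^sub>0 where "\<not> regret n A (ds y\<^sub>0) \<le> \<delta>"
      by blast
    then have "{y. regret n A (ds y) \<le> \<delta>} \<subseteq> {\<not> y\<^sub>0}"
      by (cases y\<^sub>0) (auto, metis (full_types))
    from card_mono[OF _ this] show ?thesis
      by (simp add: indicator_def)
  qed
  then have le: "(\<Sum>y\<in>UNIV. measure_pmf.prob (pair_pmf R (return_pmf (ds y))) {(A, d). regret n A d \<le> \<delta>}) \<le> 1"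
    by (rule sum_prob_pair_pmf_le)
  have ge: "1 - p \<le> measure_pmf.prob (pair_pmf R (return_pmf (ds y))) {(A, d). regret n A d \<le> \<delta>}"
    for y
  proof -
    have "return_pmf (ds y) = replicate_pmf T (return_pmf (xs, y))"
      by (simp add: ds_def replicate_pmf_return_pmf)
    then have "return_pmf (ds y) \<in> iid_inputs n T"
      using xs(1) by (force simp: iid_inputs_def days_def)
    then show ?thesis using R(1) by (simp add: achieves_regret_def)
  qed
  \<comment> \<open>The two success probabilities add up to at most 1, yet to at least
    \<open>2 * (1 - p)\<close>, which exceeds 1.\<close>
  show False
    using le ge[of True] ge[of False] p by (simp add: UNIV_bool)
qed

lemma iid_inputs_subset_all_inputs: "iid_inputs n T \<subseteq> all_inputs n T"
  by (fastforce simp: iid_inputs_def all_inputs_def streams_def set_replicate_pmf lists_eq_set)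

text \<open>A guarantee for all inputs includes the one for i.i.d. inputs, so the latter case
  suffices.\<close>

lemma needs_memoryI:
  assumes "\<And>R m. achieves_regret n (iid_inputs n T) \<delta> p R \<Longrightarrow> uses_memory n T m R \<Longrightarrow> b \<le> real m"
  shows "needs_memory n T \<delta> p b"
  using assms iid_inputs_subset_all_inputs unfolding needs_memory_def achieves_regret_def by blast

theorem theorem1p1:
  fixes p :: real
  assumes "0 < p" and "p < 1/2"
  shows "\<exists>c>0. \<forall>\<delta>::real. 0 < \<delta> \<and> \<delta> < 1/2 \<longrightarrow>
           (\<exists>c'>0. \<forall>n\<ge>2. \<forall>T\<ge>1. needs_memory n T \<delta> p (c' * (real n / (\<delta>\<^sup>2 * real T)))) \<and>
           (\<exists>T\<^sub>0. \<forall>n\<ge>2. \<forall>T\<ge>T\<^sub>0. needs_memory n T \<delta> p (c * (real n / (\<delta>\<^sup>2 * real T))))"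
proof (rule exI[of _ "(1/2 - p)\<^sup>2 / 192"], intro conjI allI impI)
  \<comment> \<open>The constant is 192 = 16 * 4 * 3: the factor of
    \<open>expert_memory_bound\<close>,
    \<open>\<epsilon>\<^sup>2 \<le> 4 * \<delta>\<^sup>2\<close>, and
    \<open>m + 2 \<le> 3 * m\<close> for positive \<open>m\<close>.\<close>
  define \<kappa> where "\<kappa> = 1/2 - p"
  have \<kappa>: "0 < \<kappa>" using assms by (simp add: \<kappa>_def)
  then show "0 < (1/2 - p)\<^sup>2 / 192" by (simp flip: \<kappa>_def)
  fix \<delta> :: real
  assume "0 < \<delta> \<and> \<delta> < 1/2"
  then have \<delta>: "0 < \<delta>" "\<delta> < 1/2" by auto
  show "\<exists>c'>0. \<forall>n\<ge>2. \<forall>T\<ge>1. needs_memory n T \<delta> p (c' * (real n / (\<delta>\<^sup>2 * real T)))"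
  proof (rule exI[of _ "\<kappa>\<^sup>2 * \<delta>\<^sup>2 / 12"], intro conjI allI impI needs_memoryI)
    \<comment> \<open>With \<open>\<epsilon> = 1/2\<close> the bound is free of \<delta>, so the
      witness cancels \<open>\<delta>\<^sup>2\<close>; the 12 is 16 * (1/4) * 3.\<close>
    show "0 < \<kappa>\<^sup>2 * \<delta>\<^sup>2 / 12" using \<kappa> \<delta> by simp
    fix n T m :: nat and R
    assume nT: "2 \<le> n" "1 \<le> T"
      and R: "achieves_regret n (iid_inputs n T) \<delta> p R" "uses_memory n T m R"
    have m: "1 \<le> real m"
      using memory_positive[OF R] nT \<delta> assms by simp
    have "real n * \<kappa>\<^sup>2 \<le> 16 * (1/2)\<^sup>2 * real T * (real m + 2)"
    \<comment> \<open>A perfect expert has no variance, so \<beta> is 0; symmetry gives \<alpha>,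
      and \<open>1 - p - 1/2\<close> is exactly \<kappa>.\<close>
    proof (rule expert_memory_bound[OF R, where \<alpha> = "1/2" and \<beta> = 0])
      show "seq_sum {-1, 1} (\<lambda>_. 1 / 2) T (\<lambda>xs. of_bool ((1/2 - \<delta>) * T \<le> sum_list xs)) \<le> 1/2"
        using nT \<delta> by (intro seq_sum_signs_pos_le) simp
    qed (use nT \<delta> \<kappa> in \<open>simp_all add: \<kappa>_def power2_eq_square\<close>)
    also have "\<dots> \<le> 16 * (1/2)\<^sup>2 * real T * (3 * real m)"
      using m by (intro mult_left_mono) auto
    finally show "\<kappa>\<^sup>2 * \<delta>\<^sup>2 / 12 * (real n / (\<delta>\<^sup>2 * real T)) \<le> real m"
      using nT \<delta> by (simp add: field_simps power2_eq_square)
  qed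
  \<comment> \<open>Of order \<delta>, strictly above \<delta>, and capped so that
    \<open>1/2 + \<epsilon>\<close> remains a probability.\<close>
  define \<epsilon> where "\<epsilon> = min (2 * \<delta>) (1/2)"
  have \<epsilon>: "0 < \<epsilon>" "\<delta> < \<epsilon>" "\<epsilon> \<le> 1/2" "\<epsilon> \<le> 2 * \<delta>"
    using \<delta> by (auto simp: \<epsilon>_def)
  \<comment> \<open>From here on Chebyshev bounds both \<alpha> and \<beta> by 1/4, which again
    leaves the advantage \<kappa>.\<close>
  obtain T\<^sub>0 :: nat where T0: "4 / (\<epsilon> - \<delta>)\<^sup>2 \<le> real T\<^sub>0"
    using real_arch_simple by blast
  show "\<exists>T\<^sub>0. \<forall>n\<ge>2. \<forall>T\<ge>T\<^sub>0. needs_memory n T \<delta> p ((1/2 - p)\<^sup>2 / 192 * (real n / (\<delta>\<^sup>2 * real T)))"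
    unfolding \<kappa>_def[symmetric]
  proof (intro exI[of _ T\<^sub>0] allI impI needs_memoryI)
    fix n T m :: nat and R
    assume n: "2 \<le> n" and "T\<^sub>0 \<le> T"
      and R: "achieves_regret n (iid_inputs n T) \<delta> p R" "uses_memory n T m R"
    have "4 / (\<epsilon> - \<delta>)\<^sup>2 \<le> real T"
      using T0 \<open>T\<^sub>0 \<le> T\<close> by linarith
    then have T4: "4 \<le> real T * (\<epsilon> - \<delta>)\<^sup>2"
      using \<epsilon> by (simp add: pos_divide_le_eq)
    then have T: "0 < T" by (cases "T = 0") auto
    have quarter: "real T / ((\<epsilon> - \<delta>) * real T)\<^sup>2 \<le> 1/4"
      using T T4 \<epsilon> by (simp add: power_mult_distrib pos_divide_le_eq) (simp add: power2_eq_square mult_ac)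
    have m: "1 \<le> real m"
      using memory_positive[OF R n T] \<delta> assms by simp
    have "real n * \<kappa>\<^sup>2 \<le> 16 * \<epsilon>\<^sup>2 * real T * (real m + 2)"
    proof (rule expert_memory_bound[OF R, where \<alpha> = "1/4" and \<beta> = "1/4"])
      show "seq_sum {-1, 1} (\<lambda>_. 1 / 2) T (\<lambda>xs. of_bool ((\<epsilon> - \<delta>) * T \<le> sum_list xs)) \<le> 1/4"
        using T \<epsilon> by (intro order.trans[OF seq_sum_signs_ge_le quarter]) simp
      have "real T * (1 - 4 * \<epsilon>\<^sup>2) \<le> real T * 1"
        by (intro mult_left_mono) auto
      then show "real T * (1 - 4 * \<epsilon>\<^sup>2) / ((\<epsilon> - \<delta>) * T)\<^sup>2 \<le> 1/4"
        by (intro order.trans[OF divide_right_mono quarter]) simp_all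
    qed (use T \<epsilon> \<kappa> in \<open>simp_all add: \<kappa>_def\<close>)
    also have "\<dots> \<le> 16 * (2 * \<delta>)\<^sup>2 * real T * (3 * real m)"
    proof -
      have "\<epsilon>\<^sup>2 \<le> (2 * \<delta>)\<^sup>2" using \<epsilon>(1,4) by (intro power_mono) linarith+
      then have "16 * \<epsilon>\<^sup>2 * real T \<le> 16 * (2 * \<delta>)\<^sup>2 * real T"
        by (intro mult_right_mono mult_left_mono) simp_all
      moreover have "real m + 2 \<le> 3 * real m" using m by linarith
      ultimately show ?thesis by (rule mult_mono) simp_all
    qed
    finally show "\<kappa>\<^sup>2 / 192 * (real n / (\<delta>\<^sup>2 * real T)) \<le> real m"
      using T \<delta> by (simp add: pos_divide_le_eq power_mult_distrib mult_ac)
  qed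
qed

end
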